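(* Let $\mathbb{F}_q$ be a finite field, $\theta$ an automorphism of $\mathbb{F}_q$, let $\Gamma=(P_1,\ldots,P_n)\in\mathbb{F}_q[X;\theta]^n$ be a $P$-independent tuple of monic skew polynomials, $P=\mathrm{lclm}(P_1,\ldots,P_n)$, $N=\deg P$, and let $K$ be an integer with $0<K\le N$. Let $t$ be a nonnegative integer with $t\le\frac{N-K}{2}$. Let $f\in\mathbb{F}_q[X;\theta]$ with $\deg f<K$, let $c=\psi_\Gamma(f)$, let $e\in\mathcal{L}=R_{P_1}\times\cdots\times R_{P_n}$ with skew poly-weight $w_\Gamma(e)\le t$, and let $y=c+e$. Then the decoding algorithm described in the context, run on input $y$ (with $\Gamma,K,t$ known), is correct: it returns $f$ (whatever nonzero kernel vector $\mathbf{u}$ is chosen in its Step 3).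
   Context: $\mathbb{F}_q[X;\theta]$ is the skew polynomial ring: polynomials $\sum a_iX^i$ with coefficients in $\mathbb{F}_q$ written on the left, usual addition, and multiplication determined by $X\cdot a=\theta(a)X$ for $a\in\mathbb{F}_q$. It is right Euclidean: for $A$ and $B\neq 0$ there are unique $S,R$ with $A=SB+R$, $\deg R<\deg B$; write $R=A\operatorname{mod}_r B$. It also admits left division: for $A$ and $B\ne 0$ there are unique $S,R$ with $A=BS+R$, $\deg R<\deg B$; write $S=A/_\ell B$ for the quotient. $\mathrm{gcrd}$ denotes the (monic) greatest common right divisor and $\mathrm{lclm}$ the (monic) least common left multiple. For a monic skew polynomial $P$, $R_P=\mathbb{F}_q[X;\theta]/\mathbb{F}_q[X;\theta]P$, identified with the set of skew polynomials of degree $<\deg P$. The tuple $\Gamma=(P_1,\ldots,P_n)$ with $P=\mathrm{lclm}(P_1,\ldots,P_n)$ is called $P$-independent if $\deg P=\sum_{i=1}^n\deg P_i$. In that case the map $\psi_\Gamma:R_P\to R_{P_1}\times\cdots\times R_{P_n}$, $f\mapsto(f\operatorname{mod}_r P_1,\ldots,f\operatorname{mod}_r P_n)$ is an isomorphism of left $\mathbb{F}_q[X;\theta]$-modules (skew Chinese Remainder Theorem). The skew poly-weight of $y\in\mathcal{L}$ associated to $\Gamma$ is $w_\Gamma(y)=\deg(P)-\deg\left(\mathrm{gcrd}(P,\psi_\Gamma^{-1}(y))\right)$, with $\mathrm{gcrd}(P,0)=P$. Decoding algorithm, input $y\in\mathcal{L}$: Step 1. Compute $Y=\psi_\Gamma^{-1}(y)\in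 R_P$. If $\deg Y<K$, return $Y$ and stop. Step 2. Otherwise form the $N\times(t+1)$ matrix $M_Y$ over $\mathbb{F}_q$ whose columns are the coefficient vectors (coefficients of $X^0,\ldots,X^{N-1}$) of $X^iY\operatorname{mod}_r P$ for $i=0,\ldots,t$, and let $B=[M_Y\mid -I_{N,K+t}]$, where $I_{N,K+t}$ consists of the first $K+t$ columns of the $N\times N$ identity matrix. Step 3. Compute a nonzero vector $\mathbf{u}=(u_0,\ldots,u_{K+2t})$ over $\mathbb{F}_q$ with $B\mathbf{u}=0$. Step 4. Set $V=\sum_{i=0}^{t}u_iX^i$ and $Q=\sum_{i=0}^{K-1+t}u_{t+1+i}X^i$, and return $Q/_\ell V$. Correctness includes that each step can be carried out: when $\deg Y\ge K$, a nonzero $\mathbf{u}$ exists and the corresponding $V$ is nonzero. *)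

theory Defs
  imports
    "HOL-Computational_Algebra.Polynomial"
    "Jordan_Normal_Form.Matrix"
begin

section \<open>Skew polynomials\<close>

text \<open>
  The skew polynomial ring has the same underlying additive group as the ordinary polynomial ring,
  so its elements are represented by the type \<^typ>\<open>'a poly\<close> (coefficients on the left), and only
  the multiplication is new.  The product \<open>p * q\<close> of commutative polynomials is never used below.
  Since \<open>X a = \<theta>(a) X\<close>, one has \<open>a X\<^sup>i \<sqdot> b X\<^sup>j = a \<theta>\<^sup>i(b) X\<^bsup>i+j\<^esup>\<close>.
\<close>

definition skew_mult :: "('a::field \<Rightarrow> 'a) \<Rightarrow> 'a poly \<Rightarrow> 'a poly \<Rightarrow> 'a poly" where
  "skew_mult \<theta> A B =
     (\<Sum>i\<le>degree A. \<Sum>j\<le>degree B. monom (coeff A i * (\<theta> ^^ i) (coeff B j)) (i + j))"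

lemma skew_mult_X_const: "\<theta> 0 = 0 \<Longrightarrow> skew_mult \<theta> (monom 1 1) [:a:] = skew_mult \<theta> [:\<theta> a:] (monom 1 1)"
  by (simp add: skew_mult_def degree_monom_eq monom_0)

text \<open>
  The library convention is \<open>degree 0 = 0\<close>, whereas the zero polynomial has degree smaller than
  every natural number here.
\<close>

definition skew_residues :: "'a::field poly \<Rightarrow> 'a poly set" where
  "skew_residues P = {f. f = 0 \<or> degree f < degree P}"

definition skew_modr :: "('a::field \<Rightarrow> 'a) \<Rightarrow> 'a poly \<Rightarrow> 'a poly \<Rightarrow> 'a poly" where
  "skew_modr \<theta> A B = (THE R. R \<in> skew_residues B \<and> (\<exists>S. A = skew_mult \<theta> S B + R))"

definition skew_divl :: "('a::field \<Rightarrow> 'a) \<Rightarrow> 'a poly \<Rightarrow> 'a poly \<Rightarrow> 'a poly" where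
  "skew_divl \<theta> A B = (THE S. \<exists>R \<in> skew_residues B. A = skew_mult \<theta> B S + R)"

definition skew_rdvd :: "('a::field \<Rightarrow> 'a) \<Rightarrow> 'a poly \<Rightarrow> 'a poly \<Rightarrow> bool" where
  "skew_rdvd \<theta> D A \<longleftrightarrow> (\<exists>S. A = skew_mult \<theta> S D)"

definition skew_gcrd :: "('a::field \<Rightarrow> 'a) \<Rightarrow> 'a poly \<Rightarrow> 'a poly \<Rightarrow> 'a poly" where
  "skew_gcrd \<theta> A B = (THE D. lead_coeff D = 1 \<and> skew_rdvd \<theta> D A \<and> skew_rdvd \<theta> D B \<and>
     (\<forall>D'. skew_rdvd \<theta> D' A \<and> skew_rdvd \<theta> D' B \<longrightarrow> skew_rdvd \<theta> D' D))"

definition skew_lclm :: "('a::field \<Rightarrow> 'a) \<Rightarrow> 'a poly list \<Rightarrow> 'a poly" where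
  "skew_lclm \<theta> Ps = (THE M. lead_coeff M = 1 \<and> (\<forall>Q \<in> set Ps. skew_rdvd \<theta> Q M) \<and>
     (\<forall>M'. (\<forall>Q \<in> set Ps. skew_rdvd \<theta> Q M') \<longrightarrow> skew_rdvd \<theta> M M'))"


section \<open>Chinese remaindering and the skew poly-weight\<close>

text \<open>Tuples of skew polynomials are lists.\<close>

definition P_independent :: "('a::field \<Rightarrow> 'a) \<Rightarrow> 'a poly list \<Rightarrow> bool" where
  "P_independent \<theta> \<Gamma> \<longleftrightarrow> degree (skew_lclm \<theta> \<Gamma>) = (\<Sum>Q\<leftarrow>\<Gamma>. degree Q)"

definition residue_tuples :: "'a::field poly list \<Rightarrow> 'a poly list set" where
  "residue_tuples \<Gamma> =
     {ys. length ys = length \<Gamma> \<and> (\<forall>i < length \<Gamma>. ys ! i \<in> skew_residues (\<Gamma> ! i))}"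

definition tuple_add :: "'a::field poly list \<Rightarrow> 'a poly list \<Rightarrow> 'a poly list" where
  "tuple_add = map2 (+)"

definition skew_crt :: "('a::field \<Rightarrow> 'a) \<Rightarrow> 'a poly list \<Rightarrow> 'a poly \<Rightarrow> 'a poly list" where
  "skew_crt \<theta> \<Gamma> f = map (skew_modr \<theta> f) \<Gamma>"

definition skew_crt_inv :: "('a::field \<Rightarrow> 'a) \<Rightarrow> 'a poly list \<Rightarrow> 'a poly list \<Rightarrow> 'a poly" where
  "skew_crt_inv \<theta> \<Gamma> = inv_into (skew_residues (skew_lclm \<theta> \<Gamma>)) (skew_crt \<theta> \<Gamma>)"

definition poly_weight :: "('a::field \<Rightarrow> 'a) \<Rightarrow> 'a poly list \<Rightarrow> 'a poly list \<Rightarrow> nat" where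
  "poly_weight \<theta> \<Gamma> y =
     degree (skew_lclm \<theta> \<Gamma>) - degree (skew_gcrd \<theta> (skew_lclm \<theta> \<Gamma>) (skew_crt_inv \<theta> \<Gamma> y))"


section \<open>The decoding algorithm\<close>

definition shift_matrix :: "('a::field \<Rightarrow> 'a) \<Rightarrow> 'a poly \<Rightarrow> nat \<Rightarrow> 'a poly \<Rightarrow> 'a mat" where
  "shift_matrix \<theta> P t Y = mat_of_cols (degree P)
     (map (\<lambda>i. vec (degree P) (coeff (skew_modr \<theta> (skew_mult \<theta> (monom 1 i) Y) P))) [0..<t + 1])"

definition decoding_matrix :: "('a::field \<Rightarrow> 'a) \<Rightarrow> 'a poly \<Rightarrow> nat \<Rightarrow> nat \<Rightarrow> 'a poly \<Rightarrow> 'a mat" where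
  "decoding_matrix \<theta> P K t Y =
     (let N = degree P;
          I = mat_of_cols N (take (K + t) (cols (1\<^sub>m N)))
      in mat_of_cols N (cols (shift_matrix \<theta> P t Y) @ cols (- I)))"

text \<open>All the vectors that may be chosen in the third step.\<close>

definition kernel_choices :: "('a::field \<Rightarrow> 'a) \<Rightarrow> 'a poly \<Rightarrow> nat \<Rightarrow> nat \<Rightarrow> 'a poly \<Rightarrow> 'a vec set" where
  "kernel_choices \<theta> P K t Y =
     {u \<in> carrier_vec (K + 2 * t + 1). u \<noteq> 0\<^sub>v (K + 2 * t + 1) \<and>
        decoding_matrix \<theta> P K t Y *\<^sub>v u = 0\<^sub>v (degree P)}"

definition decoder_V :: "nat \<Rightarrow> 'a::field vec \<Rightarrow> 'a poly" where
  "decoder_V t u = (\<Sum>i\<le>t. monom (u $ i) i)"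

definition decoder_Q :: "nat \<Rightarrow> nat \<Rightarrow> 'a::field vec \<Rightarrow> 'a poly" where
  "decoder_Q K t u = (\<Sum>i<K + t. monom (u $ (t + 1 + i)) i)"

text \<open>
  The algorithm is nondeterministic in the choice of the kernel vector; the following is the set
  of its possible results on input \<open>y\<close>.  As \<open>K > 0\<close>, the first test is also right for \<open>Y = 0\<close>.
\<close>

definition decoder_results ::
    "('a::field \<Rightarrow> 'a) \<Rightarrow> 'a poly list \<Rightarrow> nat \<Rightarrow> nat \<Rightarrow> 'a poly list \<Rightarrow> 'a poly set" where
  "decoder_results \<theta> \<Gamma> K t y =
     (let P = skew_lclm \<theta> \<Gamma>; Y = skew_crt_inv \<theta> \<Gamma> y
      in if degree Y < K then {Y}
         else {skew_divl \<theta> (decoder_Q K t u) (decoder_V t u) | u. u \<in> kernel_choices \<theta> P K t Y})"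

end

theory Submission
  imports Defs "HOL-Library.Cardinality"
begin

text \<open>
  Write \<open>Y = f + E\<close> with \<open>E = \<psi>\<^sup>-\<^sup>1(e)\<close>, and let \<open>G = gcrd(P, E)\<close>; the weight bound says
  \<open>deg G \<ge> N - t \<ge> K + t\<close>.  Some nonzero \<open>V\<close> with \<open>deg V \<le> N - deg G \<le> t\<close> annihilates \<open>E\<close> modulo
  \<open>P\<close>: over a finite field there are more such \<open>V\<close> than remainders modulo \<open>P'\<close>, where
  \<open>P = P' G\<close>.  Then \<open>V Y \<equiv> V f\<close>, which gives a kernel vector.  Conversely, every kernel vector
  satisfies \<open>V Y \<equiv> Q\<close>, so \<open>Q - V f \<equiv> V E\<close> is right divisible by \<open>G\<close> although its degree is
  smaller than \<open>K + t \<le> deg G\<close>; hence \<open>Q = V f\<close> and left division returns \<open>f\<close>.  The same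
  counting argument yields common left multiples, hence the existence of \<open>lclm\<close>.
\<close>

section \<open>Polynomials of bounded degree\<close>

text \<open>The condition on coefficients sidesteps the convention \<open>degree 0 = 0\<close>: the
  zero polynomial always belongs, and closure under sums and scalars is immediate.\<close>

definition poly_below :: "nat \<Rightarrow> 'a::zero poly set" where
  "poly_below n = {f. \<forall>i\<ge>n. coeff f i = 0}"

lemma poly_below_iff: "f \<in> poly_below n \<longleftrightarrow> f = 0 \<or> degree f < n"
proof
  assume "f \<in> poly_below n"
  then have "coeff f i = 0" if "n \<le> i" for i
    using that by (simp add: poly_below_def)
  then show "f = 0 \<or> degree f < n"
    using leading_coeff_0_iff [of f] not_le by blast
qed (auto simp: poly_below_def coeff_eq_0)

lemma skew_residues_eq: "skew_residues P = poly_below (degree P)"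
  by (auto simp: skew_residues_def poly_below_iff)

lemma zero_in_poly_below [simp]: "0 \<in> poly_below n"
  by (simp add: poly_below_def)

lemma poly_below_mono: "f \<in> poly_below m \<Longrightarrow> m \<le> n \<Longrightarrow> f \<in> poly_below n"
  by (auto simp: poly_below_def)

lemma poly_below_add: "f \<in> poly_below n \<Longrightarrow> g \<in> poly_below n \<Longrightarrow> f + g \<in> poly_below n"
  for f g :: "'a::comm_monoid_add poly"
  by (auto simp: poly_below_def)

lemma poly_below_diff: "f \<in> poly_below n \<Longrightarrow> g \<in> poly_below n \<Longrightarrow> f - g \<in> poly_below n"
  for f g :: "'a::ab_group_add poly"
  by (auto simp: poly_below_def)

lemma poly_below_smult: "f \<in> poly_below n \<Longrightarrow> Polynomial.smult a f \<in> poly_below n"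
  for f :: "'a::comm_semiring_0 poly"
  by (auto simp: poly_below_def)

lemma poly_below_sum:
  fixes f :: "'i \<Rightarrow> 'a::comm_monoid_add poly"
  shows "(\<And>i. i \<in> A \<Longrightarrow> f i \<in> poly_below n) \<Longrightarrow> sum f A \<in> poly_below n"
  by (induction A rule: infinite_finite_induct) (auto intro: poly_below_add)

text \<open>Splitting off the constant coefficient with \<open>pCons\<close> multiplies the count by
  the size of the field. These cardinalities drive all pigeonhole arguments below.\<close>

lemma card_poly_below: "card (poly_below n :: 'a::{zero,finite} poly set) = CARD('a) ^ n"
proof (induction n)
  case 0
  have "poly_below 0 = {0 :: 'a poly}"
    by (auto simp: poly_below_iff)
  then show ?case by simp
next
  case (Suc n)
  have "poly_below (Suc n) = (\<lambda>(a :: 'a, p). pCons a p) ` (UNIV \<times> poly_below n)"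
  proof (intro equalityI subsetI)
    fix f :: "'a poly"
    assume f: "f \<in> poly_below (Suc n)"
    obtain a p where "f = pCons a p" by (cases f)
    moreover from this f have "p \<in> poly_below n"
      by (auto simp: poly_below_def dest: spec [of _ "Suc _"])
    ultimately show "f \<in> (\<lambda>(a, p). pCons a p) ` (UNIV \<times> poly_below n)" by auto
  qed (auto simp: poly_below_def coeff_pCons split: nat.splits)
  moreover have "inj_on (\<lambda>(a :: 'a, p). pCons a p) (UNIV \<times> poly_below n)"
    by (auto simp: inj_on_def)
  ultimately show ?case
    by (simp add: card_image card_cartesian_product Suc.IH)
qed

lemma finite_poly_below: "finite (poly_below n :: 'a::{zero,finite} poly set)"
  by (rule card_ge_0_finite) (simp add: card_poly_below)

text \<open>Reduces identities that are additive in an argument to monomials; associativity of the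
  skew product is proved this way.\<close>

lemma poly_monom_induct [case_names zero monom add]:
  fixes p :: "'a::comm_monoid_add poly"
  assumes "P 0" "\<And>a i. P (monom a i)" "\<And>p q. P p \<Longrightarrow> P q \<Longrightarrow> P (p + q)"
  shows "P p"
proof -
  have "P (\<Sum>i\<in>A. monom (coeff p i) i)" for A
    by (induction A rule: infinite_finite_induct) (auto intro: assms)
  then show ?thesis
    by (metis poly_as_sum_of_monoms)
qed

section \<open>The skew polynomial ring\<close>

locale skew_polynomials = field_hom \<theta> for \<theta> :: "'a::field \<Rightarrow> 'a"
begin

abbreviation skew_times (infixl "\<star>" 70) where
  "A \<star> B \<equiv> skew_mult \<theta> A B"

abbreviation right_dvd (infix "rdvd" 50) where
  "D rdvd A \<equiv> skew_rdvd \<theta> D A"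

lemma funpow_0 [simp]: "(\<theta> ^^ i) 0 = 0"
  by (induction i) auto

lemma funpow_add: "(\<theta> ^^ i) (a + b) = (\<theta> ^^ i) a + (\<theta> ^^ i) b"
  by (induction i) (auto simp: hom_add)

lemma funpow_mult: "(\<theta> ^^ i) (a * b) = (\<theta> ^^ i) a * (\<theta> ^^ i) b"
  by (induction i) (auto simp: hom_mult)

lemma funpow_eq_0_iff [simp]: "(\<theta> ^^ i) a = 0 \<longleftrightarrow> a = 0"
  by (induction i) auto

text \<open>A twisted convolution whose range does not mention the degrees of the factors, so that
  additivity in each factor can be checked coefficientwise.\<close>

lemma coeff_skew_mult:
  "coeff (A \<star> B) n = (\<Sum>i\<le>n. coeff A i * (\<theta> ^^ i) (coeff B (n - i)))"
proof -
  have inner: "(\<Sum>j\<le>degree B. coeff (monom (coeff A i * (\<theta> ^^ i) (coeff B j)) (i + j)) n) =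
    (if i \<le> n then coeff A i * (\<theta> ^^ i) (coeff B (n - i)) else 0)" for i
  proof -
    have "(\<Sum>j\<le>degree B. coeff (monom (coeff A i * (\<theta> ^^ i) (coeff B j)) (i + j)) n) =
      (\<Sum>j\<le>degree B. if j = n - i \<and> i \<le> n then coeff A i * (\<theta> ^^ i) (coeff B (n - i)) else 0)"
      by (rule sum.cong) auto
    also have "\<dots> = (if i \<le> n then coeff A i * (\<theta> ^^ i) (coeff B (n - i)) else 0)"
      by (auto simp: coeff_eq_0)
    finally show ?thesis .
  qed
  have "coeff (A \<star> B) n =
    (\<Sum>i\<le>degree A. if i \<le> n then coeff A i * (\<theta> ^^ i) (coeff B (n - i)) else 0)"
    unfolding skew_mult_def coeff_sum inner ..
  also have "\<dots> = (\<Sum>i\<in>{..degree A} \<inter> {..n}. coeff A i * (\<theta> ^^ i) (coeff B (n - i)))"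
    by (subst sum.inter_restrict) auto
  also have "\<dots> = (\<Sum>i\<le>n. coeff A i * (\<theta> ^^ i) (coeff B (n - i)))"
    by (rule sum.mono_neutral_left) (auto simp: coeff_eq_0)
  finally show ?thesis .
qed

lemma skew_mult_add_left: "(A + B) \<star> C = A \<star> C + B \<star> C"
  by (rule poly_eqI) (simp add: coeff_skew_mult distrib_right sum.distrib)

lemma skew_mult_add_right: "A \<star> (B + C) = A \<star> B + A \<star> C"
  by (rule poly_eqI) (simp add: coeff_skew_mult distrib_left sum.distrib funpow_add)

lemma skew_mult_0_left [simp]: "0 \<star> A = 0"
  by (rule poly_eqI) (simp add: coeff_skew_mult)

lemma skew_mult_0_right [simp]: "A \<star> 0 = 0"
  by (rule poly_eqI) (simp add: coeff_skew_mult)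

lemma skew_mult_diff_left: "(A - B) \<star> C = A \<star> C - B \<star> C"
  using skew_mult_add_left [of "A - B" B C] by (simp add: eq_diff_eq)

lemma skew_mult_diff_right: "A \<star> (B - C) = A \<star> B - A \<star> C"
  using skew_mult_add_right [of A "B - C" C] by (simp add: eq_diff_eq)

lemma coeff_monom_skew_mult:
  "coeff (monom a i \<star> B) n = (if i \<le> n then a * (\<theta> ^^ i) (coeff B (n - i)) else 0)"
proof -
  have "coeff (monom a i \<star> B) n =
    (\<Sum>k\<le>n. if k = i then a * (\<theta> ^^ i) (coeff B (n - i)) else 0)"
    unfolding coeff_skew_mult by (rule sum.cong) auto
  then show ?thesis by simp
qed

lemma monom_skew_mult_monom: "monom a i \<star> monom b j = monom (a * (\<theta> ^^ i) b) (i + j)"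
  by (rule poly_eqI) (auto simp: coeff_monom_skew_mult)

lemma const_skew_mult: "[:a:] \<star> A = Polynomial.smult a A"
  by (rule poly_eqI) (simp flip: monom_0 add: coeff_monom_skew_mult)

text \<open>Both sides are additive in each factor, so monomials suffice. There the identity says
  that the iterates of \<open>\<theta>\<close> are multiplicative and compose by adding
  exponents.\<close>

lemma skew_mult_assoc: "A \<star> B \<star> C = A \<star> (B \<star> C)"
proof (induction A rule: poly_monom_induct)
  case (monom a i)
  show ?case
  proof (induction B rule: poly_monom_induct)
    case (monom b j)
    show ?case
    proof (induction C rule: poly_monom_induct)
      case (monom c k)
      show ?case
        by (simp add: monom_skew_mult_monom funpow_mult Nat.funpow_add mult.assoc add.assoc)
    qed (simp_all add: skew_mult_add_right)
  qed (simp_all add: skew_mult_add_right skew_mult_add_left)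
qed (simp_all add: skew_mult_add_left)

text \<open>Only the two leading terms meet in this position. Injectivity of \<open>\<theta>\<close>
  keeps the twisted leading coefficient nonzero, hence degrees add and there are no zero
  divisors.\<close>

lemma coeff_skew_mult_degree:
  "coeff (A \<star> B) (degree A + degree B) = lead_coeff A * (\<theta> ^^ degree A) (lead_coeff B)"
proof -
  have "coeff (A \<star> B) (degree A + degree B) =
    (\<Sum>i\<in>{degree A}. coeff A i * (\<theta> ^^ i) (coeff B (degree A + degree B - i)))"
    unfolding coeff_skew_mult
    by (rule sum.mono_neutral_right) (auto simp: coeff_eq_0 less_diff_conv2 not_le linorder_neq_iff)
  then show ?thesis by simp
qed

text \<open>The asymmetric bounds fit the decoder, where \<open>V\<close> has degree at most
  \<open>t\<close> and \<open>f\<close> has degree less than \<open>K\<close>.\<close>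

lemma skew_mult_below:
  assumes "A \<in> poly_below (Suc m)" "B \<in> poly_below n"
  shows "A \<star> B \<in> poly_below (m + n)"
  unfolding poly_below_def
proof (intro CollectI allI impI)
  fix k assume "m + n \<le> k"
  then have "coeff A i * (\<theta> ^^ i) (coeff B (k - i)) = 0" for i
    using assms by (cases "i \<le> m") (auto simp: poly_below_def)
  then show "coeff (A \<star> B) k = 0"
    unfolding coeff_skew_mult by (intro sum.neutral) blast
qed

lemma degree_skew_mult:
  assumes "A \<noteq> 0" "B \<noteq> 0"
  shows "degree (A \<star> B) = degree A + degree B"
proof (rule antisym)
  have "A \<star> B \<in> poly_below (degree A + Suc (degree B))"
    by (rule skew_mult_below) (simp_all add: poly_below_iff)
  then show "degree (A \<star> B) \<le> degree A + degree B"
    by (auto simp: poly_below_iff)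
  show "degree A + degree B \<le> degree (A \<star> B)"
    by (rule le_degree) (use assms in \<open>simp add: coeff_skew_mult_degree\<close>)
qed

lemma skew_mult_eq_0_iff [simp]: "A \<star> B = 0 \<longleftrightarrow> A = 0 \<or> B = 0"
proof
  assume "A \<star> B = 0"
  then have "lead_coeff A * (\<theta> ^^ degree A) (lead_coeff B) = 0"
    by (metis coeff_0 coeff_skew_mult_degree)
  then show "A = 0 \<or> B = 0" by simp
qed auto

section \<open>Right divisibility\<close>

lemma rdvd_refl [simp]: "A rdvd A"
  unfolding skew_rdvd_def by (rule exI [of _ "[:1:]"]) (simp add: const_skew_mult)

lemma rdvd_0 [simp]: "A rdvd 0"
  unfolding skew_rdvd_def by (rule exI [of _ 0]) simp

lemma rdvd_mult: "D rdvd A \<Longrightarrow> D rdvd B \<star> A"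
  unfolding skew_rdvd_def by (auto simp flip: skew_mult_assoc)

lemma rdvd_trans: "D rdvd A \<Longrightarrow> A rdvd B \<Longrightarrow> D rdvd B"
  unfolding skew_rdvd_def by (auto simp flip: skew_mult_assoc)

lemma rdvd_add: "D rdvd A \<Longrightarrow> D rdvd B \<Longrightarrow> D rdvd A + B"
  unfolding skew_rdvd_def by (auto simp flip: skew_mult_add_left)

lemma rdvd_diff: "D rdvd A \<Longrightarrow> D rdvd B \<Longrightarrow> D rdvd A - B"
  unfolding skew_rdvd_def by (auto simp flip: skew_mult_diff_left)

lemma rdvd_smult: "D rdvd A \<Longrightarrow> D rdvd Polynomial.smult a A"
  using rdvd_mult [of D A "[:a:]"] by (simp add: const_skew_mult)

lemma rdvd_sum: "(\<And>i. i \<in> I \<Longrightarrow> D rdvd F i) \<Longrightarrow> D rdvd sum F I"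
  by (induction I rule: infinite_finite_induct) (auto intro: rdvd_add)

lemma rdvd_degree_le:
  assumes "D rdvd A" "A \<noteq> 0"
  shows "degree D \<le> degree A"
  using assms by (auto simp: skew_rdvd_def degree_skew_mult)

text \<open>The common source of uniqueness: it gives unique remainders, injectivity of Chinese
  remaindering and the key equation \<open>Q = V f\<close>.\<close>

lemma rdvd_below_eq_0:
  assumes "D rdvd A" "A \<in> poly_below (degree D)"
  shows "A = 0"
  using assms rdvd_degree_le [OF assms(1)] by (cases "A = 0") (auto simp: poly_below_iff)

text \<open>Equal degrees and equal leading coefficients make the difference too short a multiple of
  \<open>A\<close> to be nonzero. This justifies the definite descriptions of gcrd and lclm.\<close>

lemma monic_rdvd_antisym:
  assumes "lead_coeff A = 1" "lead_coeff B = 1" "A rdvd B" "B rdvd A"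
  shows "A = B"
proof -
  have "A \<noteq> 0" "B \<noteq> 0"
    using assms by auto
  then have "degree A = degree B"
    using assms by (intro antisym rdvd_degree_le)
  have "coeff (A - B) i = 0" if "degree A \<le> i" for i
    using assms that \<open>degree A = degree B\<close> by (cases "i = degree A") (auto simp: coeff_eq_0)
  then have "A - B \<in> poly_below (degree A)"
    by (simp add: poly_below_def)
  moreover have "A rdvd A - B"
    using assms(3) by (intro rdvd_diff) auto
  ultimately have "A - B = 0"
    by (intro rdvd_below_eq_0)
  then show ?thesis by simp
qed

section \<open>Division with remainder on the right and on the left\<close>

lemma right_division:
  assumes "B \<noteq> 0"
  shows "\<exists>R \<in> poly_below (degree B). B rdvd A - R"
proof -
  have "\<exists>R \<in> poly_below (degree B). B rdvd A - R" if "A \<in> poly_below n" for n A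
    using that
  proof (induction n arbitrary: A)
    case 0
    then show ?case by (intro bexI [of _ A]) (auto simp: poly_below_def)
  next
    case (Suc n)
    show ?case
    proof (cases "n < degree B")
      case True
      with Suc.prems show ?thesis
        by (intro bexI [of _ A]) (auto intro: poly_below_mono)
    next
      case False
      \<comment> \<open>\<open>M \<star> B\<close> has the same coefficient at \<open>n\<close> as
        \<open>A\<close>: moving \<open>X^(n - degree B)\<close> past the leading coefficient of
        \<open>B\<close> twists it, so the division is by the twisted value.\<close>
      define M where "M = monom (coeff A n / (\<theta> ^^ (n - degree B)) (lead_coeff B)) (n - degree B)"
      have "coeff (A - M \<star> B) i = 0" if "n \<le> i" for i
      proof (cases "i = n")
        case True
        with False assms show ?thesis
          by (simp add: M_def coeff_monom_skew_mult)
      next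
        case neq: False
        with that Suc.prems have "coeff A i = 0"
          by (simp add: poly_below_def)
        moreover have "coeff B (i - (n - degree B)) = 0"
          using neq that False by (intro coeff_eq_0) auto
        ultimately show ?thesis
          by (simp add: M_def coeff_monom_skew_mult)
      qed
      then have "A - M \<star> B \<in> poly_below n"
        by (simp add: poly_below_def)
      then obtain R where R: "R \<in> poly_below (degree B)" "B rdvd A - M \<star> B - R"
        using Suc.IH by blast
      have "B rdvd (A - M \<star> B - R) + M \<star> B"
        using R(2) by (blast intro: rdvd_add rdvd_mult rdvd_refl)
      then have "B rdvd A - R"
        by (simp add: algebra_simps)
      with R(1) show ?thesis by blast
    qed
  qed
  from this [of A "Suc (degree A)"] show ?thesis
    by (simp add: poly_below_iff)
qed

lemma skew_modr_eqI:
  assumes "R \<in> poly_below (degree B)" "B rdvd A - R"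
  shows "skew_modr \<theta> A B = R"
proof -
  have *: "(\<exists>S. A = S \<star> B + T) \<longleftrightarrow> B rdvd A - T" for T
    unfolding skew_rdvd_def by (metis add_diff_cancel_right' diff_add_cancel)
  show ?thesis
    unfolding skew_modr_def skew_residues_eq *
  proof (rule the_equality)
    fix T assume T: "T \<in> poly_below (degree B) \<and> B rdvd A - T"
    \<comment> \<open>This difference is \<open>T - R\<close>, a multiple of \<open>B\<close> below
      the degree of \<open>B\<close>.\<close>
    have "B rdvd (A - R) - (A - T)"
      using assms(2) T by (blast intro: rdvd_diff)
    moreover have "T - R \<in> poly_below (degree B)"
      using T assms(1) by (intro poly_below_diff) auto
    ultimately have "T - R = 0"
      by (intro rdvd_below_eq_0 [of B]) simp_all
    then show "T = R" by simp
  qed (use assms in simp)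
qed

lemma
  assumes "B \<noteq> 0"
  shows skew_modr_below: "skew_modr \<theta> A B \<in> poly_below (degree B)"
    and rdvd_diff_skew_modr: "B rdvd A - skew_modr \<theta> A B"
  using right_division [OF assms, of A] skew_modr_eqI by auto

lemma skew_modr_eq_iff:
  assumes "B \<noteq> 0"
  shows "skew_modr \<theta> A B = skew_modr \<theta> A' B \<longleftrightarrow> B rdvd A - A'"
proof
  assume "skew_modr \<theta> A B = skew_modr \<theta> A' B"
  with rdvd_diff [OF rdvd_diff_skew_modr [OF assms, of A] rdvd_diff_skew_modr [OF assms, of A']]
  show "B rdvd A - A'" by simp
next
  assume "B rdvd A - A'"
  from rdvd_add [OF this rdvd_diff_skew_modr [OF assms, of A']]
  show "skew_modr \<theta> A B = skew_modr \<theta> A' B"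
    by (intro skew_modr_eqI skew_modr_below assms) simp
qed

lemma skew_modr_add:
  assumes "B \<noteq> 0"
  shows "skew_modr \<theta> (A + A') B = skew_modr \<theta> A B + skew_modr \<theta> A' B"
  using rdvd_add [OF rdvd_diff_skew_modr [OF assms, of A] rdvd_diff_skew_modr [OF assms, of A']]
  by (intro skew_modr_eqI poly_below_add skew_modr_below assms) (simp add: algebra_simps)

lemma skew_modr_sum_smult:
  assumes "B \<noteq> 0"
  shows "skew_modr \<theta> (\<Sum>i\<in>I. Polynomial.smult (a i) (F i)) B =
    (\<Sum>i\<in>I. Polynomial.smult (a i) (skew_modr \<theta> (F i) B))"
proof (rule skew_modr_eqI)
  show "(\<Sum>i\<in>I. Polynomial.smult (a i) (skew_modr \<theta> (F i) B)) \<in> poly_below (degree B)"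
    by (intro poly_below_sum poly_below_smult skew_modr_below assms)
  have "B rdvd (\<Sum>i\<in>I. Polynomial.smult (a i) (F i - skew_modr \<theta> (F i) B))"
    by (intro rdvd_sum rdvd_smult rdvd_diff_skew_modr assms)
  then show "B rdvd (\<Sum>i\<in>I. Polynomial.smult (a i) (F i)) -
      (\<Sum>i\<in>I. Polynomial.smult (a i) (skew_modr \<theta> (F i) B))"
    by (simp add: smult_diff_right sum_subtractf)
qed

text \<open>Exact left division is the case the decoder meets. Another quotient \<open>T\<close>
  would make \<open>B \<star> (S - T)\<close> shorter than \<open>B\<close>, although degrees
  add.\<close>

lemma skew_divl_mult:
  assumes "B \<noteq> 0"
  shows "skew_divl \<theta> (B \<star> S) B = S"
  unfolding skew_divl_def skew_residues_eq
proof (rule the_equality)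
  show "\<exists>R\<in>poly_below (degree B). B \<star> S = B \<star> S + R"
    by (intro bexI [of _ 0]) auto
next
  fix T assume "\<exists>R\<in>poly_below (degree B). B \<star> S = B \<star> T + R"
  then have below: "B \<star> (S - T) \<in> poly_below (degree B)"
    by (auto simp: skew_mult_diff_right)
  have "S - T = 0"
  proof (rule ccontr)
    assume "S - T \<noteq> 0"
    with assms below show False
      by (simp add: poly_below_iff degree_skew_mult)
  qed
  then show "T = S" by simp
qed

section \<open>Principal left ideals and greatest common right divisors\<close>

text \<open>Take a nonzero element of least degree and make it monic by a left scalar. Remainders of
  ideal elements stay in the ideal, so minimality makes them zero. Both gcrd and lclm arise as such
  generators.\<close>

lemma left_ideal_principal:
  assumes diff: "\<And>A B. A \<in> I \<Longrightarrow> B \<in> I \<Longrightarrow> A - B \<in> I"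
    and mult: "\<And>A S. A \<in> I \<Longrightarrow> S \<star> A \<in> I"
    and "M \<in> I" "M \<noteq> 0"
  obtains D where "lead_coeff D = 1" "D \<in> I" "\<And>A. A \<in> I \<Longrightarrow> D rdvd A"
proof -
  obtain D where D: "D \<in> I" "D \<noteq> 0" and min: "\<And>A. A \<in> I \<Longrightarrow> A \<noteq> 0 \<Longrightarrow> degree D \<le> degree A"
    using ex_has_least_nat [of "\<lambda>A. A \<in> I \<and> A \<noteq> 0" M degree] assms(3,4) by blast
  define D' where "D' = Polynomial.smult (inverse (lead_coeff D)) D"
  have D': "lead_coeff D' = 1" "D' \<in> I" "D' \<noteq> 0" "degree D' = degree D"
    using D mult [of D "[:inverse (lead_coeff D):]"] by (simp_all add: D'_def const_skew_mult)
  have "D' rdvd A" if "A \<in> I" for A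
  proof -
    obtain R where R: "R \<in> poly_below (degree D')" "D' rdvd A - R"
      using right_division [OF D'(3)] by blast
    then obtain S where "A - R = S \<star> D'"
      by (auto simp: skew_rdvd_def)
    then have "R = A - S \<star> D'"
      by (simp add: algebra_simps)
    then have "R \<in> I"
      using that D' by (auto intro: diff mult)
    with min [of R] R(1) D'(4) have "R = 0"
      by (cases "R = 0") (auto simp: poly_below_iff)
    with R(2) show ?thesis by simp
  qed
  with D' that show ?thesis by blast
qed

text \<open>The monic generator of the left ideal spanned by \<open>A\<close> and \<open>B\<close>
  is a gcrd: its Bezout form shows that every common right divisor divides it.\<close>

lemma
  assumes "A \<noteq> 0"
  shows skew_gcrd_rdvd_left: "skew_gcrd \<theta> A B rdvd A"
    and skew_gcrd_rdvd_right: "skew_gcrd \<theta> A B rdvd B"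
proof -
  let ?gcrd = "\<lambda>D. lead_coeff D = 1 \<and> D rdvd A \<and> D rdvd B \<and>
     (\<forall>D'. D' rdvd A \<and> D' rdvd B \<longrightarrow> D' rdvd D)"
  let ?I = "{S \<star> A + T \<star> B | S T. True}"
  have one: "[:1:] \<star> C = C" for C
    by (simp add: const_skew_mult)
  have A: "A \<in> ?I"
    by (intro CollectI exI [of _ "[:1:]"] exI [of _ 0]) (simp add: one)
  have B: "B \<in> ?I"
    by (intro CollectI exI [of _ 0] exI [of _ "[:1:]"]) (simp add: one)
  obtain D where D: "lead_coeff D = 1" "D \<in> ?I" "\<And>C. C \<in> ?I \<Longrightarrow> D rdvd C"
  proof (rule left_ideal_principal [of ?I A])
    fix C C' assume "C \<in> ?I" "C' \<in> ?I"
    then obtain S T S' T' where "C = S \<star> A + T \<star> B" "C' = S' \<star> A + T' \<star> B" by blast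
    then show "C - C' \<in> ?I"
      by (intro CollectI exI [of _ "S - S'"] exI [of _ "T - T'"]) (simp add: skew_mult_diff_left)
  next
    fix C U assume "C \<in> ?I"
    then obtain S T where "C = S \<star> A + T \<star> B" by blast
    then show "U \<star> C \<in> ?I"
      by (intro CollectI exI [of _ "U \<star> S"] exI [of _ "U \<star> T"])
        (simp add: skew_mult_add_right skew_mult_assoc)
  qed (use A assms in auto)
  have "D' rdvd D" if "D' rdvd A" "D' rdvd B" for D'
    using D(2) that by (auto intro: rdvd_add rdvd_mult)
  with D A B have "?gcrd D" by blast
  then have "?gcrd (skew_gcrd \<theta> A B)"
    unfolding skew_gcrd_def by (rule theI) (use monic_rdvd_antisym \<open>?gcrd D\<close> in blast)
  then show "skew_gcrd \<theta> A B rdvd A" "skew_gcrd \<theta> A B rdvd B" by blast+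
qed

end

section \<open>Chinese remaindering over a finite field\<close>

lemma one_less_card_field: "1 < CARD('a::{zero_neq_one,finite})"
  using card_mono [of "UNIV :: 'a set" "{0, 1}"] by simp

lemma residue_tuples_Cons:
  "residue_tuples (Q # \<Gamma>) = (\<lambda>(f, ys). f # ys) ` (poly_below (degree Q) \<times> residue_tuples \<Gamma>)"
proof (intro equalityI subsetI)
  fix ys assume "ys \<in> residue_tuples (Q # \<Gamma>)"
  then show "ys \<in> (\<lambda>(f, ys). f # ys) ` (poly_below (degree Q) \<times> residue_tuples \<Gamma>)"
    by (cases ys) (fastforce simp: residue_tuples_def skew_residues_eq)+
qed (auto simp: residue_tuples_def skew_residues_eq nth_Cons split: nat.splits)

lemma card_residue_tuples:
  "card (residue_tuples (\<Gamma> :: 'a::{field,finite} poly list)) = CARD('a) ^ (\<Sum>Q\<leftarrow>\<Gamma>. degree Q)"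
proof (induction \<Gamma>)
  case Nil
  have "residue_tuples [] = {[] :: 'a poly list}"
    by (auto simp: residue_tuples_def)
  then show ?case by simp
next
  case (Cons Q \<Gamma>)
  have "inj_on (\<lambda>(f, ys). f # ys) (poly_below (degree Q) \<times> residue_tuples \<Gamma>)"
    by (auto simp: inj_on_def)
  then show ?case
    by (simp add: residue_tuples_Cons card_image card_cartesian_product card_poly_below
        Cons.IH power_add)
qed

lemma finite_residue_tuples: "finite (residue_tuples (\<Gamma> :: 'a::{field,finite} poly list))"
  by (rule card_ge_0_finite) (simp add: card_residue_tuples)

locale finite_skew_polynomials = skew_polynomials \<theta> for \<theta> :: "'a::{field,finite} \<Rightarrow> 'a"
begin

lemma skew_crt_residue_tuples:
  assumes "0 \<notin> set \<Gamma>"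
  shows "skew_crt \<theta> \<Gamma> f \<in> residue_tuples \<Gamma>"
proof -
  have "\<Gamma> ! i \<noteq> 0" if "i < length \<Gamma>" for i
    using assms that by (metis nth_mem)
  then show ?thesis
    by (auto simp: residue_tuples_def skew_crt_def skew_residues_eq intro: skew_modr_below)
qed

lemma skew_crt_eq_iff:
  assumes "0 \<notin> set \<Gamma>"
  shows "skew_crt \<theta> \<Gamma> f = skew_crt \<theta> \<Gamma> g \<longleftrightarrow> (\<forall>Q \<in> set \<Gamma>. Q rdvd f - g)"
proof -
  have "Q \<noteq> 0" if "Q \<in> set \<Gamma>" for Q
    using assms that by blast
  then show ?thesis
    by (simp add: skew_crt_def skew_modr_eq_iff)
qed

section \<open>Least common left multiples and the Chinese remainder bijection\<close>

text \<open>Allowing one degree more than the sum of the degrees gives more polynomials than residue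
  tuples. Two of them share all residues, and their difference is the multiple.\<close>

lemma nonzero_common_left_multiple:
  assumes "0 \<notin> set \<Gamma>"
  shows "\<exists>M. M \<noteq> 0 \<and> (\<forall>Q \<in> set \<Gamma>. Q rdvd M)"
proof -
  let ?n = "\<Sum>Q\<leftarrow>\<Gamma>. degree Q"
  have "card (residue_tuples \<Gamma>) < card (poly_below (Suc ?n) :: 'a poly set)"
    unfolding card_residue_tuples card_poly_below
    by (rule power_strict_increasing) (simp_all only: one_less_card_field lessI)
  moreover have "skew_crt \<theta> \<Gamma> ` poly_below (Suc ?n) \<subseteq> residue_tuples \<Gamma>"
    using skew_crt_residue_tuples [OF assms] by blast
  ultimately have "\<not> inj_on (skew_crt \<theta> \<Gamma>) (poly_below (Suc ?n))"
    using card_inj_on_le [OF _ _ finite_residue_tuples] by fastforce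
  then obtain f g where "f \<noteq> g" "skew_crt \<theta> \<Gamma> f = skew_crt \<theta> \<Gamma> g"
    by (auto simp: inj_on_def)
  then show ?thesis
    using skew_crt_eq_iff [OF assms] by (intro exI [of _ "f - g"]) auto
qed

text \<open>Common left multiples form a nonzero left ideal, whose monic generator is the
  lclm.\<close>

lemma
  assumes "0 \<notin> set \<Gamma>"
  shows lead_coeff_skew_lclm: "lead_coeff (skew_lclm \<theta> \<Gamma>) = 1"
    and skew_lclm_rdvd_iff: "skew_lclm \<theta> \<Gamma> rdvd A \<longleftrightarrow> (\<forall>Q \<in> set \<Gamma>. Q rdvd A)"
proof -
  let ?lclm = "\<lambda>M. lead_coeff M = 1 \<and> (\<forall>Q \<in> set \<Gamma>. Q rdvd M) \<and>
     (\<forall>M'. (\<forall>Q \<in> set \<Gamma>. Q rdvd M') \<longrightarrow> M rdvd M')"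
  let ?I = "{M. \<forall>Q \<in> set \<Gamma>. Q rdvd M}"
  obtain M where "M \<noteq> 0" "\<forall>Q \<in> set \<Gamma>. Q rdvd M"
    using nonzero_common_left_multiple [OF assms] by blast
  then obtain D where "lead_coeff D = 1" "D \<in> ?I" "\<And>A. A \<in> ?I \<Longrightarrow> D rdvd A"
    by - (rule left_ideal_principal [of ?I M], auto intro: rdvd_diff rdvd_mult)
  then have "?lclm D" by simp
  then have lclm: "?lclm (skew_lclm \<theta> \<Gamma>)"
    unfolding skew_lclm_def by (rule theI) (use monic_rdvd_antisym \<open>?lclm D\<close> in blast)
  then show "lead_coeff (skew_lclm \<theta> \<Gamma>) = 1" by blast
  show "skew_lclm \<theta> \<Gamma> rdvd A \<longleftrightarrow> (\<forall>Q \<in> set \<Gamma>. Q rdvd A)"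
    using lclm by (blast intro: rdvd_trans)
qed

text \<open>Polynomials with equal residues differ by a multiple of the lclm, which gives
  injectivity. \<open>P\<close>-independence makes both finite sets equally large, which gives
  surjectivity.\<close>

lemma bij_betw_skew_crt:
  assumes "0 \<notin> set \<Gamma>" "P_independent \<theta> \<Gamma>"
  shows "bij_betw (skew_crt \<theta> \<Gamma>) (skew_residues (skew_lclm \<theta> \<Gamma>)) (residue_tuples \<Gamma>)"
proof -
  let ?P = "skew_lclm \<theta> \<Gamma>"
  have inj: "inj_on (skew_crt \<theta> \<Gamma>) (skew_residues ?P)"
  proof (rule inj_onI)
    fix f g assume *: "f \<in> skew_residues ?P" "g \<in> skew_residues ?P" "skew_crt \<theta> \<Gamma> f = skew_crt \<theta> \<Gamma> g"
    then have "?P rdvd f - g"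
      by (simp add: skew_crt_eq_iff skew_lclm_rdvd_iff assms(1))
    moreover have "f - g \<in> poly_below (degree ?P)"
      using * by (simp add: skew_residues_eq poly_below_diff)
    ultimately have "f - g = 0"
      by (rule rdvd_below_eq_0)
    then show "f = g" by simp
  qed
  moreover have "skew_crt \<theta> \<Gamma> ` skew_residues ?P = residue_tuples \<Gamma>"
  proof (rule card_subset_eq [OF finite_residue_tuples])
    show "skew_crt \<theta> \<Gamma> ` skew_residues ?P \<subseteq> residue_tuples \<Gamma>"
      using skew_crt_residue_tuples [OF assms(1)] by blast
    show "card (skew_crt \<theta> \<Gamma> ` skew_residues ?P) = card (residue_tuples \<Gamma>)"
      using assms(2) inj
      by (simp add: card_image skew_residues_eq card_poly_below card_residue_tuples P_independent_def)
  qed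
  ultimately show ?thesis
    by (simp add: bij_betw_def)
qed

lemma skew_crt_add:
  assumes "0 \<notin> set \<Gamma>"
  shows "skew_crt \<theta> \<Gamma> (f + g) = tuple_add (skew_crt \<theta> \<Gamma> f) (skew_crt \<theta> \<Gamma> g)"
  using assms by (induction \<Gamma>) (auto simp: skew_crt_def tuple_add_def skew_modr_add)

text \<open>Pigeonhole on \<open>V \<mapsto> V A mod B\<close>: there are more candidates
  \<open>V\<close> than remainders, and the difference of two colliding candidates annihilates
  \<open>A\<close>.\<close>

lemma annihilator_exists:
  assumes "B \<noteq> 0"
  shows "\<exists>V. V \<noteq> 0 \<and> V \<in> poly_below (Suc (degree B)) \<and> B rdvd V \<star> A"
proof -
  let ?n = "degree B"
  let ?h = "\<lambda>V. skew_modr \<theta> (V \<star> A) B"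
  have "card (poly_below ?n :: 'a poly set) < card (poly_below (Suc ?n) :: 'a poly set)"
    unfolding card_poly_below
    by (rule power_strict_increasing) (simp_all only: one_less_card_field lessI)
  moreover have "?h ` poly_below (Suc ?n) \<subseteq> poly_below ?n"
    using skew_modr_below [OF assms] by blast
  ultimately have "\<not> inj_on ?h (poly_below (Suc ?n))"
    using card_inj_on_le [OF _ _ finite_poly_below] by fastforce
  then obtain V W where "V \<in> poly_below (Suc ?n)" "W \<in> poly_below (Suc ?n)" "V \<noteq> W" "?h V = ?h W"
    by (auto simp: inj_on_def)
  then show ?thesis
    using skew_modr_eq_iff [OF assms]
    by (intro exI [of _ "V - W"]) (auto simp: poly_below_diff skew_mult_diff_left)
qed

end

section \<open>The decoder\<close>

lemma coeff_decoder_V: "coeff (decoder_V t u) i = (if i \<le> t then u $ i else 0)"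
  by (simp add: decoder_V_def coeff_sum)

lemma coeff_decoder_Q: "coeff (decoder_Q K t u) i = (if i < K + t then u $ (t + 1 + i) else 0)"
  by (simp add: decoder_Q_def coeff_sum)

lemma decoder_V_below: "decoder_V t u \<in> poly_below (Suc t)"
  by (simp add: poly_below_def coeff_decoder_V)

lemma decoder_Q_below: "decoder_Q K t u \<in> poly_below (K + t)"
  by (simp add: poly_below_def coeff_decoder_Q)

text \<open>The bound on \<open>K + t\<close> ensures that \<open>take\<close> really yields
  \<open>K + t\<close> columns of the identity matrix.\<close>

lemma decoding_matrix_carrier:
  fixes P :: "'a::field poly"
  assumes "K + t \<le> degree P"
  shows "decoding_matrix \<theta> P K t Y \<in> carrier_mat (degree P) (K + 2 * t + 1)"
proof -
  have "length (cols (shift_matrix \<theta> P t Y)) = t + 1"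
    unfolding shift_matrix_def cols_length mat_of_cols_carrier by simp
  moreover have "length (cols (- mat_of_cols (degree P)
      (take (K + t) (cols (1\<^sub>m (degree P)))) :: 'a mat)) = K + t"
    using assms by simp
  ultimately show ?thesis
    unfolding decoding_matrix_def Let_def by (intro carrier_matI) simp_all
qed

lemma decoding_matrix_index:
  assumes "K + t \<le> degree P" "r < degree P" "j < K + 2 * t + 1"
  shows "decoding_matrix \<theta> P K t Y $$ (r, j) =
    (if j < t + 1 then coeff (skew_modr \<theta> (skew_mult \<theta> (monom 1 j) Y) P) r
     else if r = j - (t + 1) then - 1 else 0)"
proof -
  let ?N = "degree P"
  let ?L = "map (\<lambda>i. vec ?N (coeff (skew_modr \<theta> (skew_mult \<theta> (monom 1 i) Y) P))) [0..<t + 1]"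
  let ?I = "mat_of_cols ?N (take (K + t) (cols (1\<^sub>m ?N))) :: 'a mat"
  have L: "cols (shift_matrix \<theta> P t Y) = ?L"
    unfolding shift_matrix_def by (rule cols_mat_of_cols) auto
  have len: "length (cols (- ?I)) = K + t"
    using assms(1) by simp
  have *: "decoding_matrix \<theta> P K t Y $$ (r, j) = (?L @ cols (- ?I)) ! j $ r"
    unfolding decoding_matrix_def Let_def L
    by (rule mat_of_cols_index) (use assms len in simp_all)
  show ?thesis
  proof (cases "j < t + 1")
    case True
    then show ?thesis
      unfolding * using assms(2) by (simp add: nth_append del: upt_Suc)
  next
    case False
    then have "(?L @ cols (- ?I)) ! j = col (- ?I) (j - (t + 1))"
      using assms by (simp add: nth_append)
    with False assms show ?thesis
      unfolding * by (simp add: mat_of_cols_index)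
  qed
qed

section \<open>Kernel vectors as solutions of a congruence modulo \<open>P\<close>\<close>

context skew_polynomials
begin

text \<open>Coefficients stand on the left, so \<open>V Y\<close> is a left linear combination of
  the shifts \<open>X^i Y\<close>, and right reduction respects such combinations. This is why
  linear algebra applies.\<close>

lemma skew_modr_decoder_V:
  assumes "P \<noteq> 0"
  shows "skew_modr \<theta> (decoder_V t u \<star> Y) P =
    (\<Sum>i\<le>t. Polynomial.smult (u $ i) (skew_modr \<theta> (monom 1 i \<star> Y) P))"
proof -
  have "decoder_V t u \<star> Y = (\<Sum>i\<le>t. Polynomial.smult (u $ i) (monom 1 i \<star> Y))"
  proof (rule poly_eqI)
    fix n
    have "coeff (decoder_V t u \<star> Y) n =
      (\<Sum>i\<le>n. if i \<le> t then u $ i * (\<theta> ^^ i) (coeff Y (n - i)) else 0)"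
      unfolding coeff_skew_mult coeff_decoder_V by (rule sum.cong) auto
    also have "\<dots> = (\<Sum>i\<in>{..n} \<inter> {..t}. u $ i * (\<theta> ^^ i) (coeff Y (n - i)))"
      by (subst sum.inter_restrict) auto
    also have "\<dots> = (\<Sum>i\<in>{..t} \<inter> {..n}. u $ i * (\<theta> ^^ i) (coeff Y (n - i)))"
      by (simp only: Int_commute)
    also have "\<dots> = (\<Sum>i\<le>t. if i \<le> n then u $ i * (\<theta> ^^ i) (coeff Y (n - i)) else 0)"
      by (subst sum.inter_restrict) auto
    also have "\<dots> = coeff (\<Sum>i\<le>t. Polynomial.smult (u $ i) (monom 1 i \<star> Y)) n"
      unfolding coeff_sum by (rule sum.cong) (auto simp: coeff_monom_skew_mult)
    finally show "coeff (decoder_V t u \<star> Y) n =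
      coeff (\<Sum>i\<le>t. Polynomial.smult (u $ i) (monom 1 i \<star> Y)) n" .
  qed
  then show ?thesis
    by (simp add: skew_modr_sum_smult [OF assms])
qed

lemma decoding_matrix_mult_vec:
  assumes "P \<noteq> 0" "K + t \<le> degree P" "u \<in> carrier_vec (K + 2 * t + 1)" "r < degree P"
  shows "(decoding_matrix \<theta> P K t Y *\<^sub>v u) $ r =
    coeff (skew_modr \<theta> (decoder_V t u \<star> Y) P - decoder_Q K t u) r"
proof -
  let ?B = "decoding_matrix \<theta> P K t Y"
  have "(?B *\<^sub>v u) $ r = (\<Sum>j\<in>{0..<K + 2 * t + 1}. ?B $$ (r, j) * u $ j)"
    using decoding_matrix_carrier [OF assms(2), of \<theta> Y] assms(3,4)
    by (simp add: scalar_prod_def)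
  also have "\<dots> = (\<Sum>j\<in>{0..<t + 1}. ?B $$ (r, j) * u $ j) +
      (\<Sum>j\<in>{t + 1..<K + 2 * t + 1}. ?B $$ (r, j) * u $ j)"
    by (rule sum.atLeastLessThan_concat [symmetric]) auto
  also have "(\<Sum>j\<in>{0..<t + 1}. ?B $$ (r, j) * u $ j) =
      (\<Sum>j\<le>t. u $ j * coeff (skew_modr \<theta> (monom 1 j \<star> Y) P) r)"
    by (rule sum.cong) (auto simp: decoding_matrix_index [OF assms(2,4)])
  also have "\<dots> = coeff (skew_modr \<theta> (decoder_V t u \<star> Y) P) r"
    by (simp add: skew_modr_decoder_V [OF assms(1)] coeff_sum)
  \<comment> \<open>Row \<open>r\<close> meets the negated identity block only in column
    \<open>t + 1 + r\<close>; if that column lies outside the block, the coefficient of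
    \<open>Q\<close> at \<open>r\<close> is zero as well.\<close>
  also have "(\<Sum>j\<in>{t + 1..<K + 2 * t + 1}. ?B $$ (r, j) * u $ j) =
      (\<Sum>j\<in>{t + 1..<K + 2 * t + 1}. if j = t + 1 + r then - (u $ j) else 0)"
    by (rule sum.cong) (auto simp: decoding_matrix_index [OF assms(2,4)])
  also have "\<dots> = - coeff (decoder_Q K t u) r"
    using assms(2,4) by (subst sum.delta) (auto simp: coeff_decoder_Q)
  finally show ?thesis by simp
qed

text \<open>Passes from the matrix equation to \<open>V Y \<equiv> Q\<close> modulo
  \<open>P\<close>. As \<open>Q\<close> has degree below that of \<open>P\<close>, it must be the
  remainder itself, and comparing the first \<open>degree P\<close> coefficients decides
  equality.\<close>

lemma mem_kernel_choices_iff: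
  assumes "P \<noteq> 0" "K + t \<le> degree P" "u \<in> carrier_vec (K + 2 * t + 1)"
  shows "u \<in> kernel_choices \<theta> P K t Y \<longleftrightarrow>
    u \<noteq> 0\<^sub>v (K + 2 * t + 1) \<and> P rdvd decoder_V t u \<star> Y - decoder_Q K t u"
proof -
  let ?V = "decoder_V t u" and ?Q = "decoder_Q K t u" and ?B = "decoding_matrix \<theta> P K t Y"
  have Q: "?Q \<in> poly_below (degree P)"
    using decoder_Q_below assms(2) by (rule poly_below_mono)
  then have "skew_modr \<theta> (?V \<star> Y) P - ?Q \<in> poly_below (degree P)"
    by (intro poly_below_diff skew_modr_below assms)
  then have "skew_modr \<theta> (?V \<star> Y) P = ?Q \<longleftrightarrow>
      (\<forall>r<degree P. coeff (skew_modr \<theta> (?V \<star> Y) P - ?Q) r = 0)"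
    by (auto simp: poly_below_def poly_eq_iff not_le [symmetric])
  also have "\<dots> \<longleftrightarrow> ?B *\<^sub>v u = 0\<^sub>v (degree P)"
    using decoding_matrix_carrier [OF assms(2), of \<theta> Y]
    by (auto simp: vec_eq_iff decoding_matrix_mult_vec [OF assms] simp del: index_mult_mat_vec)
  finally have "?B *\<^sub>v u = 0\<^sub>v (degree P) \<longleftrightarrow> skew_modr \<theta> (?V \<star> Y) P = ?Q" ..
  also have "\<dots> \<longleftrightarrow> P rdvd ?V \<star> Y - ?Q"
    using skew_modr_eqI [OF Q] rdvd_diff_skew_modr [OF assms(1), of "?V \<star> Y"] by auto
  finally show ?thesis
    using assms(3) by (simp add: kernel_choices_def)
qed

text \<open>If \<open>V\<close> vanishes, then \<open>P\<close> right divides the shorter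
  \<open>Q\<close>, so \<open>Q\<close> vanishes too. The entries of \<open>u\<close> are exactly
  the coefficients of \<open>V\<close> and \<open>Q\<close>, so \<open>u\<close> would be
  zero.\<close>

lemma kernel_choices_decoder_V_nonzero:
  assumes "K + t \<le> degree P" "P \<noteq> 0" "u \<in> kernel_choices \<theta> P K t Y"
  shows "decoder_V t u \<noteq> 0"
proof
  assume V: "decoder_V t u = 0"
  have u: "u \<in> carrier_vec (K + 2 * t + 1)"
    using assms(3) by (simp add: kernel_choices_def)
  have "P rdvd 0 - (decoder_V t u \<star> Y - decoder_Q K t u)"
    using mem_kernel_choices_iff [OF assms(2,1) u] assms(3) by (blast intro: rdvd_diff rdvd_0)
  then have "P rdvd decoder_Q K t u"
    by (simp add: V)
  then have Q: "decoder_Q K t u = 0"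
    by (rule rdvd_below_eq_0) (rule poly_below_mono [OF decoder_Q_below assms(1)])
  have "u $ i = 0" if "i < K + 2 * t + 1" for i
  proof (cases "i \<le> t")
    case True
    then show ?thesis
      using V coeff_decoder_V [of t u i] by simp
  next
    case False
    then have "t + 1 + (i - (t + 1)) = i" "i - (t + 1) < K + t"
      using that by simp_all
    then show ?thesis
      using Q coeff_decoder_Q [of K t u "i - (t + 1)"] by (simp del: add_Suc_right)
  qed
  then have "u = 0\<^sub>v (K + 2 * t + 1)"
    using u by auto
  then show False
    using assms(3) by (simp add: kernel_choices_def)
qed

lemma kernel_choices_key_equation:
  assumes "K + t \<le> degree P" "P \<noteq> 0" "u \<in> kernel_choices \<theta> P K t (f + E)"
    and "f \<in> poly_below K" "G rdvd P" "G rdvd E" "K + t \<le> degree G"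
  shows "decoder_Q K t u = decoder_V t u \<star> f"
proof -
  let ?V = "decoder_V t u" and ?Q = "decoder_Q K t u"
  have u: "u \<in> carrier_vec (K + 2 * t + 1)"
    using assms(3) by (simp add: kernel_choices_def)
  \<comment> \<open>Both terms are multiples of \<open>G\<close>: the first through
    \<open>E\<close>, the second through \<open>P\<close>. The terms in \<open>E\<close> cancel and
    leave \<open>Q - V f\<close>.\<close>
  have "G rdvd ?V \<star> E - (?V \<star> (f + E) - ?Q)"
    using mem_kernel_choices_iff [OF assms(2,1) u] assms(3,5,6)
    by (blast intro: rdvd_diff rdvd_mult rdvd_trans)
  then have "G rdvd ?Q - ?V \<star> f"
    by (simp add: skew_mult_add_right)
  moreover have "?Q - ?V \<star> f \<in> poly_below (K + t)"
    using skew_mult_below [OF decoder_V_below [of t u] assms(4)] decoder_Q_below [of K t u]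
    by (intro poly_below_diff) (simp_all only: add.commute)
  then have "?Q - ?V \<star> f \<in> poly_below (degree G)"
    using assms(7) by (rule poly_below_mono)
  ultimately have "?Q - ?V \<star> f = 0"
    by (rule rdvd_below_eq_0)
  then show ?thesis by simp
qed

end

lemma (in finite_skew_polynomials) kernel_choices_nonempty:
  assumes "K + t \<le> degree P" "P \<noteq> 0" "f \<in> poly_below K"
    and "G rdvd P" "G rdvd E" "degree P \<le> t + degree G"
  shows "kernel_choices \<theta> P K t (f + E) \<noteq> {}"
proof -
  obtain P' E' where P': "P = P' \<star> G" and E': "E = E' \<star> G"
    using assms(4,5) by (auto simp: skew_rdvd_def)
  with assms(2) have "P' \<noteq> 0" "G \<noteq> 0" by auto
  then have deg: "degree P' \<le> t"
    using assms(6) by (simp add: P' degree_skew_mult)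
  \<comment> \<open>Annihilating \<open>E'\<close> modulo \<open>P'\<close> instead of
    \<open>E\<close> modulo \<open>P\<close> keeps the degree of \<open>V\<close> at most
    \<open>t\<close>; multiplying by \<open>G\<close> on the right restores \<open>P\<close> and
    \<open>E\<close>.\<close>
  obtain V where V: "V \<noteq> 0" "V \<in> poly_below (Suc (degree P'))" "P' rdvd V \<star> E'"
    using annihilator_exists [OF \<open>P' \<noteq> 0\<close>] by blast
  then have Vt: "V \<in> poly_below (Suc t)"
    using deg poly_below_mono Suc_le_mono by blast
  have PVE: "P rdvd V \<star> E"
    using V(3) unfolding skew_rdvd_def P' E' by (metis skew_mult_assoc)
  \<comment> \<open>The \<open>t + 1\<close> coefficients of \<open>V\<close> come first, followed
    by the \<open>K + t\<close> coefficients of \<open>V f\<close>, which is to play the role of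
    \<open>Q\<close>.\<close>
  define u where "u = vec (K + 2 * t + 1)
    (\<lambda>i. if i \<le> t then coeff V i else coeff (V \<star> f) (i - (t + 1)))"
  have "V \<star> f \<in> poly_below (K + t)"
    using skew_mult_below [OF Vt assms(3)] by (simp add: add.commute)
  then have VQ: "decoder_V t u = V" "decoder_Q K t u = V \<star> f"
    using Vt by (auto simp: poly_eq_iff coeff_decoder_V coeff_decoder_Q u_def poly_below_def)
  have "u \<noteq> 0\<^sub>v (K + 2 * t + 1)"
  proof
    assume "u = 0\<^sub>v (K + 2 * t + 1)"
    then have "decoder_V t u = 0"
      by (simp add: poly_eq_iff coeff_decoder_V)
    with VQ V(1) show False by simp
  qed
  moreover have "u \<in> carrier_vec (K + 2 * t + 1)"
    by (simp add: u_def)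
  ultimately have "u \<in> kernel_choices \<theta> P K t (f + E)"
    using mem_kernel_choices_iff [OF assms(2,1)] PVE by (simp add: VQ skew_mult_add_right)
  then show ?thesis by blast
qed

text \<open>Equality with the singleton \<open>{f}\<close> asserts both that some run yields a
  result and that every run yields \<open>f\<close>. The first conjunct records that the kernel step
  can be carried out and that the left division is by a nonzero \<open>V\<close>.\<close>

theorem proposition7:
  fixes \<theta> :: "'a::{field,finite} \<Rightarrow> 'a"
    and \<Gamma> :: "'a poly list" and P f :: "'a poly" and c e y :: "'a poly list"
    and N K t :: nat
  assumes "field_isom \<theta>"
    and "\<forall>Q \<in> set \<Gamma>. lead_coeff Q = 1"
    and "P = skew_lclm \<theta> \<Gamma>"
    and "P_independent \<theta> \<Gamma>"
    and "N = degree P"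
    and "0 < K" and "K \<le> N"
    and "real t \<le> (real N - real K) / 2"
    and "degree f < K"
    and "c = skew_crt \<theta> \<Gamma> f"
    and "e \<in> residue_tuples \<Gamma>"
    and "poly_weight \<theta> \<Gamma> e \<le> t"
    and "y = tuple_add c e"
  shows "(K \<le> degree (skew_crt_inv \<theta> \<Gamma> y) \<longrightarrow>
            kernel_choices \<theta> P K t (skew_crt_inv \<theta> \<Gamma> y) \<noteq> {} \<and>
            (\<forall>u \<in> kernel_choices \<theta> P K t (skew_crt_inv \<theta> \<Gamma> y). decoder_V t u \<noteq> 0)) \<and>
         decoder_results \<theta> \<Gamma> K t y = {f}"
proof -
  interpret field_isom \<theta> by (fact assms(1))
  interpret finite_skew_polynomials \<theta> ..
  define E where "E = skew_crt_inv \<theta> \<Gamma> e"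
  define Y where "Y = skew_crt_inv \<theta> \<Gamma> y"
  define G where "G = skew_gcrd \<theta> P E"
  have \<Gamma>: "0 \<notin> set \<Gamma>"
    using assms(2) by auto
  have "P \<noteq> 0"
    using lead_coeff_skew_lclm [OF \<Gamma>] assms(3) by auto
  have bij: "bij_betw (skew_crt \<theta> \<Gamma>) (poly_below N) (residue_tuples \<Gamma>)"
    using bij_betw_skew_crt [OF \<Gamma> assms(4)] assms(3,5) by (simp add: skew_residues_eq)
  have inv_eq: "skew_crt_inv \<theta> \<Gamma> = inv_into (poly_below N) (skew_crt \<theta> \<Gamma>)"
    using assms(3,5) by (simp add: skew_crt_inv_def skew_residues_eq)
  have f: "f \<in> poly_below K"
    using assms(9) by (simp add: poly_below_iff)
  have E: "E \<in> poly_below N" "skew_crt \<theta> \<Gamma> E = e"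
    using bij assms(11) unfolding E_def inv_eq
    by (auto simp: bij_betw_def intro: inv_into_into f_inv_into_f)
  have "f + E \<in> poly_below N"
    using f E(1) assms(7) by (blast intro: poly_below_add poly_below_mono)
  moreover have "skew_crt \<theta> \<Gamma> (f + E) = y"
    using E(2) assms(10,13) by (simp add: skew_crt_add [OF \<Gamma>])
  \<comment> \<open>The inverse is additive here because \<open>f + E\<close> is already reduced
    modulo \<open>P\<close> and has residues \<open>y\<close>.\<close>
  ultimately have Y: "Y = f + E"
    using bij unfolding Y_def inv_eq bij_betw_def by (auto intro: inv_into_f_eq)
  have G: "G rdvd P" "G rdvd E"
    unfolding G_def using \<open>P \<noteq> 0\<close> by (rule skew_gcrd_rdvd_left, rule skew_gcrd_rdvd_right)
  have t: "K + 2 * t \<le> N"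
  proof -
    have "real (K + 2 * t) \<le> real N"
      using assms(8) by simp
    then show ?thesis
      by (simp only: of_nat_le_iff)
  qed
  have "N - degree G \<le> t"
    using assms(3,5,12) by (simp add: poly_weight_def G_def E_def)
  \<comment> \<open>Undoing the truncated subtraction is sound for an upper bound;
    \<open>K + 2 * t \<le> N\<close> then gives the second inequality.\<close>
  with t have deg_G: "N \<le> t + degree G" "K + t \<le> degree G" by simp_all
  have Kt: "K + t \<le> degree P"
    using t assms(5) by simp
  \<comment> \<open>An early exit is correct because \<open>E = Y - f\<close> is then a multiple of
    \<open>G\<close> of degree below \<open>K\<close>, hence zero.\<close>
  have short: "Y = f" if "degree Y < K"
  proof -
    have "Y - f \<in> poly_below K"
      using that f by (intro poly_below_diff) (simp_all add: poly_below_iff)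
    then have "E \<in> poly_below (degree G)"
      using deg_G(2) Y by (auto intro: poly_below_mono)
    then have "E = 0"
      using G(2) rdvd_below_eq_0 by blast
    then show ?thesis by (simp add: Y)
  qed
  have nonempty: "kernel_choices \<theta> P K t Y \<noteq> {}"
    unfolding Y using kernel_choices_nonempty [OF Kt \<open>P \<noteq> 0\<close> f G] deg_G(1) assms(5) by simp
  have V: "decoder_V t u \<noteq> 0" if "u \<in> kernel_choices \<theta> P K t Y" for u
    using kernel_choices_decoder_V_nonzero [OF Kt \<open>P \<noteq> 0\<close> that] .
  have Q: "decoder_Q K t u = decoder_V t u \<star> f" if "u \<in> kernel_choices \<theta> P K t Y" for u
    using kernel_choices_key_equation [OF Kt \<open>P \<noteq> 0\<close> that [unfolded Y] f G deg_G(2)] .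
  have result: "skew_divl \<theta> (decoder_Q K t u) (decoder_V t u) = f"
    if "u \<in> kernel_choices \<theta> P K t Y" for u
    using V [OF that] by (simp add: Q [OF that] skew_divl_mult)
  have "decoder_results \<theta> \<Gamma> K t y = {f}"
  proof (cases "degree Y < K")
    case True
    then show ?thesis
      using short by (simp add: decoder_results_def Let_def flip: Y_def)
  next
    case False
    then have "decoder_results \<theta> \<Gamma> K t y =
        {skew_divl \<theta> (decoder_Q K t u) (decoder_V t u) | u. u \<in> kernel_choices \<theta> P K t Y}"
      by (simp add: decoder_results_def Let_def assms(3) flip: Y_def)
    also have "\<dots> = {f}"
      using nonempty result by (auto 4 3)
    finally show ?thesis .
  qed
  with nonempty V show ?thesis
    unfolding Y_def by blast
qed

end
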